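(* Let $p\ge 1$. Ellipses centered at the origin are the only homothetic solutions, within $\mathcal{K}_{sym}$, of the expanding $p$-centro affine flow $\frac{\partial}{\partial t}s=s\left(\frac{\kappa}{s^3}\right)^{-\frac{p}{p+2}}$. That is, a solution $\{K_t\}_{t\in[0,T)}\subset\mathcal{K}_{sym}$ of the flow is homothetic if and only if $\partial K_0$ is an ellipse centered at the origin.
   Context: $\mathcal{K}_{sym}$ denotes the set of compact, strictly convex bodies $K\subset\mathbb{R}^2$, centrally symmetric about the origin, that are smoothly embedded, i.e. whose Gauss parametrization (by the outward unit normal $z=(\cos\theta,\sin\theta)$) is a smooth embedding of $\mathbb{S}^1$; in particular the curvature $\kappa$ of the boundary is positive. For $K\in\mathcal{K}_{sym}$, $s=s(\theta)$ is the support function and $\kappa=1/(s_{\theta\theta}+s)$ is the curvature of $\partial K$, as functions on $\mathbb{S}^1$. A family $K_t\in\mathcal{K}_{sym}$ solves the flow if its support functions $s(\theta,t)$ satisfy the displayed equation. A solution is homothetic if $K_t=\lambda(t)K_0$ for some scalar function $\lambda(t)>0$ for all $t\in[0,T)$. *)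

theory Defs
  imports "HOL-Analysis.Analysis"
begin

definition unit_normal :: "real \<Rightarrow> real^2" where
  "unit_normal \<theta> = vector [cos \<theta>, sin \<theta>]"

text \<open>Functions on the unit circle are represented as \<open>2\<pi>\<close>-periodic functions of the
  angle \<open>\<theta>\<close> of the outward unit normal.\<close>

definition support_fun :: "(real^2) set \<Rightarrow> real \<Rightarrow> real" where
  "support_fun K \<theta> = (SUP x\<in>K. x \<bullet> unit_normal \<theta>)"

definition curvature :: "(real^2) set \<Rightarrow> real \<Rightarrow> real" where
  "curvature K \<theta> = 1 / (deriv (deriv (support_fun K)) \<theta> + support_fun K \<theta>)"

definition strictly_convex :: "(real^2) set \<Rightarrow> bool" where
  "strictly_convex K \<longleftrightarrow> (\<forall>x\<in>K. \<forall>y\<in>K. x \<noteq> y \<longrightarrow> open_segment x y \<subseteq> interior K)"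

text \<open>The point of \<open>K\<close> with outward unit normal \<open>unit_normal \<theta>\<close>; it exists and is unique
  when \<open>K\<close> is nonempty, compact and strictly convex.\<close>

definition gauss_param :: "(real^2) set \<Rightarrow> real \<Rightarrow> real^2" where
  "gauss_param K \<theta> = (THE x. x \<in> K \<and> (\<forall>y\<in>K. y \<bullet> unit_normal \<theta> \<le> x \<bullet> unit_normal \<theta>))"

definition smooth :: "(real \<Rightarrow> 'a::real_normed_vector) \<Rightarrow> bool" where
  "smooth f \<longleftrightarrow> (\<forall>n t. ((\<lambda>g x. vector_derivative g (at x)) ^^ n) f differentiable (at t))"

text \<open>As the circle is compact, a smooth embedding is the same as an injective smooth immersion.\<close>

definition smooth_circle_embedding :: "(real \<Rightarrow> real^2) \<Rightarrow> bool" where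
  "smooth_circle_embedding \<gamma> \<longleftrightarrow>
     smooth \<gamma> \<and> (\<forall>\<theta>. \<gamma> (\<theta> + 2 * pi) = \<gamma> \<theta>) \<and> inj_on \<gamma> {0..<2 * pi} \<and>
     (\<forall>\<theta>. vector_derivative \<gamma> (at \<theta>) \<noteq> 0)"

definition K_sym :: "(real^2) set set" where
  "K_sym = {K. compact K \<and> interior K \<noteq> {} \<and> strictly_convex K \<and> (\<forall>x\<in>K. - x \<in> K) \<and>
               smooth_circle_embedding (gauss_param K)}"

text \<open>The final time \<open>T\<close> may be infinite.\<close>

definition time_interval :: "ereal \<Rightarrow> real set" where
  "time_interval T = {t. 0 \<le> t \<and> ereal t < T}"

text \<open>At \<open>t = 0\<close> the time derivative is one-sided.\<close>

definition centro_affine_flow :: "real \<Rightarrow> ereal \<Rightarrow> (real \<Rightarrow> (real^2) set) \<Rightarrow> bool" where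
  "centro_affine_flow p T K \<longleftrightarrow>
     (\<forall>t\<in>time_interval T. K t \<in> K_sym) \<and>
     (\<forall>t\<in>time_interval T. \<forall>\<theta>.
        ((\<lambda>\<tau>. support_fun (K \<tau>) \<theta>) has_real_derivative
           support_fun (K t) \<theta> *
             (curvature (K t) \<theta> / support_fun (K t) \<theta> ^ 3) powr (- (p / (p + 2))))
        (at t within time_interval T))"

definition homothetic :: "ereal \<Rightarrow> (real \<Rightarrow> (real^2) set) \<Rightarrow> bool" where
  "homothetic T K \<longleftrightarrow>
     (\<exists>c :: real \<Rightarrow> real. \<forall>t\<in>time_interval T. c t > 0 \<and> K t = (\<lambda>x. c t *\<^sub>R x) ` K 0)"

definition centered_ellipse :: "(real^2) set \<Rightarrow> bool" where
  "centered_ellipse E \<longleftrightarrow>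
     (\<exists>u v a b. norm u = 1 \<and> norm v = 1 \<and> u \<bullet> v = 0 \<and> a > 0 \<and> b > 0 \<and>
        E = {x. (x \<bullet> u)\<^sup>2 / a\<^sup>2 + (x \<bullet> v)\<^sup>2 / b\<^sup>2 = 1})"

end

theory Submission
  imports Defs
begin

text \<open>
  Write \<open>s\<close> for the support function, \<open>r = s'' + s\<close> for the radius of curvature and
  \<open>q = p / (p + 2)\<close>. The flow reads \<open>\<partial>s / \<partial>t = s * (s\<^sup>3 * r) powr q\<close>, and everything turns on the
  condition that \<open>s\<^sup>3 * r\<close> be a constant \<open>A\<close> on the circle. By
  \<open>ellipse_iff_centro_affine_curvature_const\<close> this characterises the ellipses centered at the origin:
  the equation \<open>s\<^sup>3 * (s'' + s) = A\<close> becomes linear for \<open>s\<^sup>2\<close>, with the solutions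
  \<open>s\<^sup>2 = a\<^sup>2 * cos\<^sup>2 (\<theta> - \<alpha>) + b\<^sup>2 * sin\<^sup>2 (\<theta> - \<alpha>)\<close>, which are the squared support functions of ellipses.

  If the solution is homothetic, then \<open>(\<partial>s / \<partial>t) / s\<close> at time 0 is the same for all \<open>\<theta>\<close>, and hence
  \<open>s\<^sup>3 * r\<close> is constant initially.

  Conversely, let \<open>s\<^sup>3 * r = A\<close> initially. There is a homothetic solution with these initial data, and
  the point is that there is no other one. This is a parabolic comparison argument
  (\<open>flow_ratio_to_ellipse\<close>): at an angle where the ratio \<open>u\<close> of the current to the initial support
  function is smallest, the current body touches a dilate of the initial one from outside, so its
  curvature there is at most that of the dilate and \<open>u\<close> grows at least as fast as for the homothetic
  solution; where \<open>u\<close> is largest, it grows at most that fast. By the maximum principle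
  (\<open>parabolic_max_principle\<close>) \<open>u\<close> remains independent of \<open>\<theta>\<close>, and the support function determines the
  body. The joint continuity that the maximum principle needs is not part of the notion of a
  solution; it results from the monotonicity of the flow and from the Lipschitz bound for support
  functions (\<open>support_fun_flow_continuous\<close>).
\<close>

section \<open>Maxima and the parabolic maximum principle\<close>

text \<open>If \<open>d\<close> were positive, the first derivative, which vanishes there, would be positive just to the
  right, and the function would exceed its maximum.\<close>

lemma second_derivative_at_max:
  fixes g :: "real \<Rightarrow> real"
  assumes g: "\<And>y. (g has_real_derivative g' y) (at y)"
    and g': "(g' has_real_derivative d) (at x)"
    and max: "\<And>y. g y \<le> g x"
  shows "d \<le> 0"
proof (rule ccontr)
  assume "\<not> d \<le> 0"
  have 0: "g' x = 0"
    using DERIV_local_max[OF g, of 1 x] max by auto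
  obtain \<delta> where \<delta>: "\<delta> > 0" "\<And>h. 0 < h \<Longrightarrow> h < \<delta> \<Longrightarrow> g' x < g' (x + h)"
    using DERIV_pos_inc_right[OF g'] \<open>\<not> d \<le> 0\<close> by auto
  obtain z where z: "x < z" "z < x + \<delta> / 2" "g (x + \<delta> / 2) - g x = (x + \<delta> / 2 - x) * g' z"
    using MVT2[of x "x + \<delta> / 2" g g'] \<delta>(1) g by force
  have "g' z > 0" using \<delta>(2)[of "z - x"] z 0 by auto
  then have "(x + \<delta> / 2 - x) * g' z > 0" using \<delta>(1) by simp
  then show False using z(3) max[of "x + \<delta> / 2"] by linarith
qed

text \<open>The maximum principle for parabolic equations, freed from the equation: all that matters is
  that \<open>w\<close> does not increase in time at points where it is spatially maximal.
  If \<open>w\<close> became positive, then so would \<open>w x \<tau> - \<epsilon> * \<tau>\<close> for a small \<open>\<epsilon>\<close>; at its maximum over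
  space and time it has derivative at most \<open>- \<epsilon>\<close> in time, hence was larger shortly before.\<close>

lemma parabolic_max_principle:
  fixes w :: "'a::metric_space \<Rightarrow> real \<Rightarrow> real"
  assumes "compact S"
    and cont: "continuous_on ({0..t} \<times> S) (\<lambda>(\<tau>, x). w x \<tau>)"
    and init: "\<And>x. x \<in> S \<Longrightarrow> w x 0 \<le> 0"
    and step: "\<And>x \<tau>. \<lbrakk>x \<in> S; 0 < \<tau>; \<tau> \<le> t; \<And>y. y \<in> S \<Longrightarrow> w y \<tau> \<le> w x \<tau>\<rbrakk>
      \<Longrightarrow> \<exists>d\<le>0. (w x has_real_derivative d) (at \<tau> within {0..t})"
    and x: "x \<in> S" and "0 \<le> t"
  shows "w x t \<le> 0"
proof (rule ccontr)
  assume "\<not> w x t \<le> 0"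
  then have pos: "w x t > 0" and "t > 0"
    using init[OF x] \<open>0 \<le> t\<close> by (auto simp: less_le)
  define \<epsilon> where "\<epsilon> = w x t / (2 * t)"
  have \<epsilon>: "\<epsilon> > 0" "\<epsilon> * t = w x t / 2" using pos \<open>t > 0\<close> by (auto simp: \<epsilon>_def)
  have c: "continuous_on ({0..t} \<times> S) (\<lambda>z. (case z of (\<tau>, x) \<Rightarrow> w x \<tau>) - \<epsilon> * fst z)"
    by (intro continuous_intros cont)
  have ne: "compact ({0..t} \<times> S)" "{0..t} \<times> S \<noteq> {}"
    using \<open>compact S\<close> x \<open>0 \<le> t\<close> by (auto intro!: compact_Times)
  obtain y \<tau> where y\<tau>: "y \<in> S" "0 \<le> \<tau>" "\<tau> \<le> t"
    and max: "\<And>y' \<tau>'. \<lbrakk>y' \<in> S; 0 \<le> \<tau>'; \<tau>' \<le> t\<rbrakk> \<Longrightarrow> w y' \<tau>' - \<epsilon> * \<tau>' \<le> w y \<tau> - \<epsilon> * \<tau>"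
    using continuous_attains_sup[OF ne c] by auto
  have "\<tau> \<noteq> 0"
    using max[OF x \<open>0 \<le> t\<close> order_refl] \<epsilon>(2) pos init[OF y\<tau>(1)] by auto
  then have "\<tau> > 0" using y\<tau> by simp
  have "w y' \<tau> \<le> w y \<tau>" if "y' \<in> S" for y'
    using max[of y' \<tau>] that y\<tau> by simp
  then obtain d where d: "d \<le> 0" "(w y has_real_derivative d) (at \<tau> within {0..t})"
    using step y\<tau> \<open>\<tau> > 0\<close> by blast
  have D: "((\<lambda>s. w y s - \<epsilon> * s) has_real_derivative d - \<epsilon>) (at \<tau> within {0..t})"
    using d(2) by (auto intro!: derivative_eq_intros)
  obtain \<delta> where \<delta>: "\<delta> > 0" "\<And>h. \<lbrakk>h > 0; \<tau> - h \<in> {0..t}; h < \<delta>\<rbrakk>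
      \<Longrightarrow> w y \<tau> - \<epsilon> * \<tau> < w y (\<tau> - h) - \<epsilon> * (\<tau> - h)"
    using has_real_derivative_neg_dec_left[OF D] d(1) \<epsilon>(1) by (metis add_nonpos_neg diff_conv_add_uminus neg_less_0_iff_less)
  define h where "h = min (\<delta> / 2) \<tau>"
  have "h > 0" "h < \<delta>" "\<tau> - h \<in> {0..t}"
    using \<delta>(1) \<open>\<tau> > 0\<close> y\<tau> by (auto simp: h_def min_def)
  then show False
    using \<delta>(2)[of h] max[OF y\<tau>(1), of "\<tau> - h"] by auto
qed

section \<open>Plane geometry in the frame of a unit normal\<close>

lemma inner_unit_normal: "x \<bullet> unit_normal \<theta> = x $ 1 * cos \<theta> + x $ 2 * sin \<theta>"
  by (simp add: unit_normal_def inner_vec_def sum_2)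

lemma norm_unit_normal [simp]: "norm (unit_normal \<theta>) = 1"
  by (simp add: unit_normal_def norm_vec_def L2_set_def sum_2)

lemma inner_unit_normals: "unit_normal \<theta> \<bullet> unit_normal \<phi> = cos (\<theta> - \<phi>)"
  by (simp add: inner_unit_normal) (simp add: unit_normal_def cos_diff)

lemma inner_unit_normal_self [simp]: "unit_normal \<theta> \<bullet> unit_normal \<theta> = 1"
  by (simp add: inner_unit_normals)

lemma polar_form: "\<exists>\<theta>. (x::real^2) = norm x *\<^sub>R unit_normal \<theta>"
proof (cases "x = 0")
  case False
  have "norm x ^ 2 = (x $ 1)\<^sup>2 + (x $ 2)\<^sup>2"
    by (simp add: norm_vec_def L2_set_def sum_2)
  then have "(x $ 1 / norm x)\<^sup>2 + (x $ 2 / norm x)\<^sup>2 = 1"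
    using False by (metis add_divide_distrib divide_self norm_eq_zero power_divide power_not_zero)
  then obtain \<theta> where "x $ 1 / norm x = cos \<theta>" "x $ 2 / norm x = sin \<theta>"
    using sincos_total_2pi by metis
  then have "x $ 1 = norm x * cos \<theta>" "x $ 2 = norm x * sin \<theta>"
    using False by (metis mult.commute nonzero_divide_eq_eq norm_eq_zero)+
  then have "x = norm x *\<^sub>R unit_normal \<theta>"
    unfolding vec_eq_iff forall_2 unit_normal_def by simp
  then show ?thesis ..
qed auto

lemma has_vector_derivative_unit_normal:
  "(unit_normal has_vector_derivative unit_normal (\<theta> + pi / 2)) (at \<theta>)"
proof -
  have eq: "unit_normal = (\<lambda>\<theta>. cos \<theta> *\<^sub>R axis 1 1 + sin \<theta> *\<^sub>R axis 2 1)"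
    by (auto simp: unit_normal_def vec_eq_iff forall_2 axis_def)
  have "((\<lambda>\<theta>. cos \<theta> *\<^sub>R axis 1 1 + sin \<theta> *\<^sub>R axis 2 1 :: real^2) has_vector_derivative
      (- sin \<theta>) *\<^sub>R axis 1 1 + cos \<theta> *\<^sub>R axis 2 1) (at \<theta>)"
    by (auto intro!: derivative_eq_intros simp: has_vector_derivative_def algebra_simps)
  then show ?thesis
    unfolding eq by (simp add: cos_add sin_add)
qed

lemma unit_normal_add_pi: "unit_normal (\<theta> + pi) = - unit_normal \<theta>"
  by (simp add: unit_normal_def vec_eq_iff forall_2)

lemma plane_expansion:
  "x = (x \<bullet> unit_normal \<theta>) *\<^sub>R unit_normal \<theta>
     + (x \<bullet> unit_normal (\<theta> + pi / 2)) *\<^sub>R unit_normal (\<theta> + pi / 2)"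
proof -
  have "a = cos \<theta> * (cos \<theta> * a) + sin \<theta> * (sin \<theta> * a)" for a
    using sin_cos_squared_add[of \<theta>] by algebra
  from this[of "x $ 1"] this[of "x $ 2"] show ?thesis
    unfolding inner_unit_normal vec_eq_iff forall_2
    by (simp add: unit_normal_def cos_add sin_add algebra_simps)
qed

section \<open>Support functions of compact convex sets\<close>

lemma support_fun_attained:
  assumes "compact K" "K \<noteq> {}"
  obtains x where "x \<in> K" "support_fun K \<theta> = x \<bullet> unit_normal \<theta>"
    "\<And>y. y \<in> K \<Longrightarrow> y \<bullet> unit_normal \<theta> \<le> x \<bullet> unit_normal \<theta>"
proof -
  have "continuous_on K (\<lambda>x. x \<bullet> unit_normal \<theta>)"
    by (intro continuous_intros)
  then obtain x where x: "x \<in> K" "\<And>y. y \<in> K \<Longrightarrow> y \<bullet> unit_normal \<theta> \<le> x \<bullet> unit_normal \<theta>"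
    using continuous_attains_sup[OF assms] by blast
  moreover have "support_fun K \<theta> = x \<bullet> unit_normal \<theta>"
    unfolding support_fun_def by (rule cSup_eq_maximum) (use x in auto)
  ultimately show ?thesis using that by blast
qed

lemma support_fun_upper:
  assumes "compact K" "x \<in> K"
  shows "x \<bullet> unit_normal \<theta> \<le> support_fun K \<theta>"
  using assms by (metis support_fun_attained empty_iff)

text \<open>A point of \<open>K\<close> outside \<open>L\<close> is separated from \<open>L\<close> by a line, and in the direction normal
  to that line \<open>K\<close> reaches further than \<open>L\<close>.\<close>

lemma support_fun_le_imp_subset:
  assumes K: "compact K" and L: "compact L" "convex L" "L \<noteq> {}"
    and le: "\<And>\<theta>. support_fun K \<theta> \<le> support_fun L \<theta>"
  shows "K \<subseteq> L"
proof
  fix x assume x: "x \<in> K"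
  show "x \<in> L"
  proof (rule ccontr)
    assume "x \<notin> L"
    then obtain a b where ab: "a \<bullet> x < b" "\<And>y. y \<in> L \<Longrightarrow> b < a \<bullet> y"
      using separating_hyperplane_closed_point[of L x] L compact_imp_closed by metis
    \<comment> \<open>The outward normal is \<open>- a\<close>, since \<open>L\<close> lies on the side where \<open>a \<bullet> y\<close> is large.\<close>
    obtain \<theta> where \<theta>: "- a = norm (- a) *\<^sub>R unit_normal \<theta>"
      using polar_form by blast
    obtain y where y: "y \<in> L" "support_fun L \<theta> = y \<bullet> unit_normal \<theta>"
      using support_fun_attained L by metis
    have "x \<bullet> unit_normal \<theta> \<le> y \<bullet> unit_normal \<theta>"
      using support_fun_upper[OF K x, of \<theta>] le[of \<theta>] y by simp
    then have "norm (- a) * (x \<bullet> unit_normal \<theta>) \<le> norm (- a) * (y \<bullet> unit_normal \<theta>)"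
      by (intro mult_left_mono) auto
    then have "x \<bullet> (- a) \<le> y \<bullet> (- a)"
      by (metis \<theta> inner_scaleR_right)
    with ab(1) ab(2)[OF y(1)] show False by (simp add: inner_commute)
  qed
qed

lemma support_fun_inject:
  assumes "compact K" "convex K" "K \<noteq> {}" "compact L" "convex L" "L \<noteq> {}"
    and "\<And>\<theta>. support_fun K \<theta> = support_fun L \<theta>"
  shows "K = L"
  using assms by (intro equalityI support_fun_le_imp_subset) auto

lemma support_fun_scaleR:
  assumes "compact K" "K \<noteq> {}" "c \<ge> 0"
  shows "support_fun ((\<lambda>x. c *\<^sub>R x) ` K) \<theta> = c * support_fun K \<theta>"
proof -
  obtain x where x: "x \<in> K" "support_fun K \<theta> = x \<bullet> unit_normal \<theta>"
    "\<And>y. y \<in> K \<Longrightarrow> y \<bullet> unit_normal \<theta> \<le> x \<bullet> unit_normal \<theta>"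
    using support_fun_attained assms by metis
  show ?thesis
    unfolding support_fun_def[of "_ ` _"]
    by (rule cSup_eq_maximum) (use x assms in \<open>auto simp: image_image intro!: mult_left_mono image_eqI[of _ _ x]\<close>)
qed

text \<open>The unit normal moves with speed 1, so each of the functions \<open>\<theta> \<mapsto> x \<bullet> unit_normal \<theta>\<close>,
  whose supremum is the support function, has Lipschitz constant \<open>norm x\<close>.\<close>

lemma support_fun_lipschitz:
  assumes K: "compact K" "K \<noteq> {}" and R: "\<And>x. x \<in> K \<Longrightarrow> norm x \<le> R"
  shows "\<bar>support_fun K \<theta> - support_fun K \<phi>\<bar> \<le> R * \<bar>\<theta> - \<phi>\<bar>"
proof -
  have R0: "R \<ge> 0" using R K(2) norm_ge_zero order_trans by blast
  have nrm: "norm (unit_normal \<theta> - unit_normal \<phi>) \<le> \<bar>\<theta> - \<phi>\<bar>" for \<theta> \<phi>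
  proof -
    have "norm (unit_normal \<theta> - unit_normal \<phi>) \<le> 1 * norm (\<theta> - \<phi>)"
    proof (rule differentiable_bound[OF convex_UNIV])
      fix x :: real
      show "(unit_normal has_derivative (\<lambda>h. h *\<^sub>R unit_normal (x + pi / 2))) (at x within UNIV)"
        using has_vector_derivative_unit_normal by (simp add: has_vector_derivative_def)
      show "onorm (\<lambda>h. h *\<^sub>R unit_normal (x + pi / 2)) \<le> 1"
        by (rule onorm_le) simp
    qed auto
    then show ?thesis by simp
  qed
  have le: "support_fun K \<theta> - support_fun K \<phi> \<le> R * \<bar>\<theta> - \<phi>\<bar>" for \<theta> \<phi>
  proof -
    obtain x where x: "x \<in> K" "support_fun K \<theta> = x \<bullet> unit_normal \<theta>"
      using support_fun_attained K by metis
    have "support_fun K \<theta> - support_fun K \<phi> \<le> x \<bullet> (unit_normal \<theta> - unit_normal \<phi>)"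
      using support_fun_upper[OF K(1) x(1), of \<phi>] x(2) by (simp add: inner_diff_right)
    also have "\<dots> \<le> norm x * norm (unit_normal \<theta> - unit_normal \<phi>)"
      by (rule norm_cauchy_schwarz)
    also have "\<dots> \<le> R * \<bar>\<theta> - \<phi>\<bar>"
      using R[OF x(1)] nrm R0 by (intro mult_mono) auto
    finally show ?thesis .
  qed
  show ?thesis using le[of \<theta> \<phi>] le[of \<phi> \<theta>] by (simp add: abs_minus_commute abs_le_iff)
qed

text \<open>From an interior point one can still move in the direction of the normal.\<close>

lemma interior_below_support_fun:
  assumes "compact K" "x \<in> interior K"
  shows "x \<bullet> unit_normal \<theta> < support_fun K \<theta>"
proof -
  obtain e where e: "e > 0" "cball x e \<subseteq> K"
    using assms(2) by (meson mem_interior_cball)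
  have "x + e *\<^sub>R unit_normal \<theta> \<in> K"
    using e by (auto simp: dist_norm intro!: subsetD[OF e(2)])
  from support_fun_upper[OF assms(1) this, of \<theta>] e(1) show ?thesis
    by (simp add: inner_add_left)
qed

lemma support_fun_frontier:
  assumes "compact K" "K \<noteq> {}"
  shows "support_fun (frontier K) \<theta> = support_fun K \<theta>"
proof -
  obtain x where x: "x \<in> K" "support_fun K \<theta> = x \<bullet> unit_normal \<theta>"
    "\<And>y. y \<in> K \<Longrightarrow> y \<bullet> unit_normal \<theta> \<le> x \<bullet> unit_normal \<theta>"
    using support_fun_attained assms by metis
  have fr: "frontier K = K - interior K"
    using assms(1) by (simp add: frontier_def compact_imp_closed)
  have "x \<in> frontier K"
    using interior_below_support_fun[OF assms(1), of x \<theta>] x fr by auto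
  then show ?thesis
    unfolding support_fun_def[of "frontier K"] x(2)
    by (intro cSup_eq_maximum) (use x(3) fr in auto)
qed

text \<open>The boundary determines the support function, because linear functions attain their maxima on
  it. This turns a hypothesis on the boundary curve into one on the support function.\<close>

lemma frontier_inject:
  fixes K L :: "(real^2) set"
  assumes "compact K" "convex K" "K \<noteq> {}" "compact L" "convex L" "L \<noteq> {}"
    and "frontier K = frontier L"
  shows "K = L"
proof (rule support_fun_inject[OF assms(1-6)])
  show "support_fun K \<theta> = support_fun L \<theta>" for \<theta>
    using support_fun_frontier[OF assms(1,3), of \<theta>] support_fun_frontier[OF assms(4,6), of \<theta>]
    by (simp add: assms(7))
qed

section \<open>Regularity of the support function of a smooth symmetric body\<close>

definition radius_of_curvature :: "(real^2) set \<Rightarrow> real \<Rightarrow> real" where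
  "radius_of_curvature K \<theta> = deriv (deriv (support_fun K)) \<theta> + support_fun K \<theta>"

context
  fixes K :: "(real^2) set"
  assumes K: "K \<in> K_sym"
begin

lemma K_sym_compact: "compact K"
  using K by (simp add: K_sym_def)

lemma K_sym_convex: "convex K"
  unfolding convex_contains_open_segment
proof (intro ballI)
  fix x y assume "x \<in> K" "y \<in> K"
  then show "open_segment x y \<subseteq> K"
    using K interior_subset[of K] by (cases "x = y") (auto simp: K_sym_def strictly_convex_def)
qed

lemma K_sym_nonempty: "K \<noteq> {}"
  using K by (auto simp: K_sym_def)

text \<open>An interior point \<open>x\<close> lies strictly below the supporting line and \<open>- x\<close> weakly below it.\<close>

lemma support_fun_pos: "support_fun K \<theta> > 0"
proof -
  obtain x where x: "x \<in> interior K" using K by (auto simp: K_sym_def)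
  then have "- x \<in> K" using K interior_subset by (auto simp: K_sym_def)
  with support_fun_upper[OF K_sym_compact this, of \<theta>]
    interior_below_support_fun[OF K_sym_compact x, of \<theta>]
  show ?thesis by simp
qed

text \<open>Strict convexity makes the point with a given outward normal unique: otherwise the midpoint
  of two such points would be an interior point on the supporting line.\<close>

lemma gauss_param:
  "gauss_param K \<theta> \<in> K" "gauss_param K \<theta> \<bullet> unit_normal \<theta> = support_fun K \<theta>"
proof -
  let ?P = "\<lambda>x. x \<in> K \<and> (\<forall>y\<in>K. y \<bullet> unit_normal \<theta> \<le> x \<bullet> unit_normal \<theta>)"
  obtain x where x: "x \<in> K" "support_fun K \<theta> = x \<bullet> unit_normal \<theta>"
    "\<And>y. y \<in> K \<Longrightarrow> y \<bullet> unit_normal \<theta> \<le> x \<bullet> unit_normal \<theta>"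
    using support_fun_attained[OF K_sym_compact K_sym_nonempty] by metis
  have "z = x" if "?P z" for z
  proof (rule ccontr)
    assume "z \<noteq> x"
    then have "open_segment z x \<subseteq> interior K"
      using K that x(1) by (simp add: K_sym_def strictly_convex_def)
    with \<open>z \<noteq> x\<close> have "midpoint z x \<in> interior K" by auto
    from interior_below_support_fun[OF K_sym_compact this, of \<theta>]
    have "midpoint z x \<bullet> unit_normal \<theta> < x \<bullet> unit_normal \<theta>" by (simp add: x(2))
    moreover have "z \<bullet> unit_normal \<theta> = x \<bullet> unit_normal \<theta>"
      using that x by (intro order_antisym) auto
    ultimately show False
      by (simp add: midpoint_def inner_add_left)
  qed
  then have "gauss_param K \<theta> = x"
    unfolding gauss_param_def using x by (intro the_equality) auto
  then show "gauss_param K \<theta> \<in> K" "gauss_param K \<theta> \<bullet> unit_normal \<theta> = support_fun K \<theta>"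
    using x by auto
qed

text \<open>The Gauss parametrization \<open>\<gamma>\<close> gives \<open>s = \<gamma> \<bullet> n\<close>, and \<open>\<gamma>' \<bullet> n = 0\<close> since the boundary point is
  extremal in its normal direction. Hence \<open>s' = \<gamma> \<bullet> n'\<close>, in which \<open>\<gamma>\<close> can be differentiated once
  more, and \<open>s'' + s = \<gamma>' \<bullet> n'\<close>: this is nonzero because \<open>\<gamma>\<close> is an immersion, and it is nonnegative
  because \<open>s\<close> lies above each of the functions \<open>\<phi> \<mapsto> \<gamma> \<theta> \<bullet> unit_normal \<phi>\<close> and touches it at \<open>\<theta>\<close>.\<close>

lemma support_fun_derivatives:
  shows DERIV_support_fun:
      "(support_fun K has_real_derivative deriv (support_fun K) \<theta>) (at \<theta>)"
    and DERIV2_support_fun: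
      "(deriv (support_fun K) has_real_derivative deriv (deriv (support_fun K)) \<theta>) (at \<theta>)"
    and radius_of_curvature_pos: "0 < radius_of_curvature K \<theta>"
proof -
  let ?\<gamma> = "gauss_param K" and ?s = "support_fun K"
  define \<gamma>' where "\<gamma>' \<theta> = vector_derivative ?\<gamma> (at \<theta>)" for \<theta>
  have emb: "smooth_circle_embedding ?\<gamma>" using K by (simp add: K_sym_def)
  then have "((\<lambda>g x. vector_derivative g (at x)) ^^ 0) ?\<gamma> differentiable (at \<theta>)" for \<theta>
    unfolding smooth_circle_embedding_def smooth_def by blast
  then have \<gamma>': "(?\<gamma> has_vector_derivative \<gamma>' \<theta>) (at \<theta>)" for \<theta>
    by (simp add: \<gamma>'_def flip: vector_derivative_works)
  have \<gamma>'_ne: "\<gamma>' \<theta> \<noteq> 0" for \<theta>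
    using emb by (simp add: smooth_circle_embedding_def \<gamma>'_def)
  have n': "((\<lambda>\<theta>. unit_normal (\<theta> + c)) has_vector_derivative unit_normal (\<theta> + c + pi / 2)) (at \<theta>)"
    for \<theta> c
  proof -
    have "((\<lambda>\<theta>. \<theta> + c) has_vector_derivative 1) (at \<theta>)"
      by (auto intro!: derivative_eq_intros)
    from vector_diff_chain_at[OF this has_vector_derivative_unit_normal] show ?thesis
      by (simp add: o_def)
  qed
  have inner': "((\<lambda>\<theta>. f \<theta> \<bullet> g \<theta>) has_real_derivative f \<theta> \<bullet> g' + f' \<bullet> g \<theta>) (at \<theta>)"
    if "(f has_vector_derivative f') (at \<theta>)" "(g has_vector_derivative g') (at \<theta>)"
    for f g :: "real \<Rightarrow> real^2" and f' g' \<theta>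
    unfolding has_real_derivative_iff_has_vector_derivative
    by (rule bounded_bilinear.has_vector_derivative[OF bounded_bilinear_inner that])
  have tangent: "\<gamma>' \<theta> \<bullet> unit_normal \<theta> = 0" for \<theta>
  proof -
    have "((\<lambda>\<phi>. ?\<gamma> \<phi> \<bullet> unit_normal \<theta>) has_real_derivative ?\<gamma> \<theta> \<bullet> 0 + \<gamma>' \<theta> \<bullet> unit_normal \<theta>) (at \<theta>)"
      by (intro inner' \<gamma>' has_vector_derivative_const)
    then show ?thesis
      using DERIV_local_max[of _ _ \<theta> 1] support_fun_upper[OF K_sym_compact gauss_param(1)]
      by (auto simp: gauss_param(2))
  qed
  have s_eq: "?s = (\<lambda>\<theta>. ?\<gamma> \<theta> \<bullet> unit_normal \<theta>)"
    by (simp add: gauss_param(2))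
  have s': "(?s has_real_derivative ?\<gamma> \<theta> \<bullet> unit_normal (\<theta> + pi / 2)) (at \<theta>)" for \<theta>
    using inner'[OF \<gamma>'[of \<theta>] has_vector_derivative_unit_normal] by (simp add: s_eq tangent)
  then have ds: "deriv ?s = (\<lambda>\<theta>. ?\<gamma> \<theta> \<bullet> unit_normal (\<theta> + pi / 2))"
    by (intro ext DERIV_imp_deriv)
  have s'': "(deriv ?s has_real_derivative \<gamma>' \<theta> \<bullet> unit_normal (\<theta> + pi / 2) - ?s \<theta>) (at \<theta>)" for \<theta>
    using inner'[OF \<gamma>'[of \<theta>] n'[of "pi / 2" \<theta>]]
    by (simp add: ds add.assoc unit_normal_add_pi gauss_param(2))
  then have dds: "deriv (deriv ?s) \<theta> = \<gamma>' \<theta> \<bullet> unit_normal (\<theta> + pi / 2) - ?s \<theta>" for \<theta>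
    by (rule DERIV_imp_deriv)
  show "(?s has_real_derivative deriv ?s \<theta>) (at \<theta>)"
    using s' by (simp add: ds)
  show "(deriv ?s has_real_derivative deriv (deriv ?s) \<theta>) (at \<theta>)"
    using s'' by (simp add: dds)
  have "- ?s \<theta> - deriv (deriv ?s) \<theta> \<le> 0"
  proof (rule second_derivative_at_max)
    let ?x = "?\<gamma> \<theta>"
    show "((\<lambda>\<phi>. ?x \<bullet> unit_normal \<phi> - ?s \<phi>) has_real_derivative
        ?x \<bullet> unit_normal (\<phi> + pi / 2) - deriv ?s \<phi>) (at \<phi>)" for \<phi>
      using DERIV_diff[OF inner'[OF has_vector_derivative_const has_vector_derivative_unit_normal] s']
      by (simp add: ds)
    show "((\<lambda>\<phi>. ?x \<bullet> unit_normal (\<phi> + pi / 2) - deriv ?s \<phi>) has_real_derivative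
        - ?s \<theta> - deriv (deriv ?s) \<theta>) (at \<theta>)"
      using DERIV_diff[OF inner'[OF has_vector_derivative_const n'] s'', of ?x "pi / 2" \<theta>]
      by (simp add: dds add.assoc unit_normal_add_pi gauss_param(2))
    show "?x \<bullet> unit_normal \<phi> - ?s \<phi> \<le> ?x \<bullet> unit_normal \<theta> - ?s \<theta>" for \<phi>
      using support_fun_upper[OF K_sym_compact gauss_param(1)] by (simp add: gauss_param(2))
  qed
  moreover have "\<gamma>' \<theta> \<bullet> unit_normal (\<theta> + pi / 2) \<noteq> 0"
    using plane_expansion[of "\<gamma>' \<theta>" \<theta>] tangent[of \<theta>] \<gamma>'_ne[of \<theta>] by auto
  ultimately show "0 < radius_of_curvature K \<theta>"
    by (simp add: radius_of_curvature_def dds)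
qed

end

section \<open>Ellipses and their support functions\<close>

definition filled_ellipse :: "real \<Rightarrow> real \<Rightarrow> real \<Rightarrow> (real^2) set" where
  "filled_ellipse \<alpha> a b =
     {x. (x \<bullet> unit_normal \<alpha>)\<^sup>2 / a\<^sup>2 + (x \<bullet> unit_normal (\<alpha> + pi / 2))\<^sup>2 / b\<^sup>2 \<le> 1}"

text \<open>The second axis is determined by the first up to a sign, which the squares absorb.\<close>

lemma centered_ellipse_polar:
  "centered_ellipse E \<longleftrightarrow> (\<exists>\<alpha> a b. a > 0 \<and> b > 0 \<and>
     E = {x. (x \<bullet> unit_normal \<alpha>)\<^sup>2 / a\<^sup>2 + (x \<bullet> unit_normal (\<alpha> + pi / 2))\<^sup>2 / b\<^sup>2 = 1})"
  (is "_ = ?rhs")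
proof
  assume "centered_ellipse E"
  then obtain u v a b where uv: "norm u = 1" "norm v = 1" "u \<bullet> v = 0" "a > 0" "b > 0"
    "E = {x. (x \<bullet> u)\<^sup>2 / a\<^sup>2 + (x \<bullet> v)\<^sup>2 / b\<^sup>2 = 1}"
    unfolding centered_ellipse_def by blast
  obtain \<alpha> where \<alpha>: "u = unit_normal \<alpha>"
    using polar_form[of u] uv(1) by auto
  define m k where "m = unit_normal (\<alpha> + pi / 2)" and "k = v \<bullet> m"
  have v: "v = k *\<^sub>R m"
    using plane_expansion[of v \<alpha>] uv(3) by (simp add: \<alpha> inner_commute m_def k_def)
  then have "k\<^sup>2 = 1"
    using uv(2) by (simp add: m_def abs_square_eq_1)
  then have "(x \<bullet> v)\<^sup>2 = (x \<bullet> m)\<^sup>2" for x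
    by (simp add: v power_mult_distrib)
  then show ?rhs using uv(4-6) \<alpha> m_def by auto
next
  assume ?rhs
  then obtain \<alpha> a b where ab: "a > 0" "b > 0" and E:
     "E = {x. (x \<bullet> unit_normal \<alpha>)\<^sup>2 / a\<^sup>2 + (x \<bullet> unit_normal (\<alpha> + pi / 2))\<^sup>2 / b\<^sup>2 = 1}"
    by blast
  have "unit_normal \<alpha> \<bullet> unit_normal (\<alpha> + pi / 2) = 0"
    by (simp add: inner_unit_normals)
  then show "centered_ellipse E"
    unfolding centered_ellipse_def using ab E
    by (intro exI[of _ "unit_normal \<alpha>"] exI[of _ "unit_normal (\<alpha> + pi / 2)"] exI[of _ a] exI[of _ b]) simp
qed

lemma
  assumes "a > 0" "b > 0"
  shows compact_filled_ellipse: "compact (filled_ellipse \<alpha> a b)"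
    and convex_filled_ellipse: "convex (filled_ellipse \<alpha> a b)"
    and filled_ellipse_nonempty: "filled_ellipse \<alpha> a b \<noteq> {}"
    and frontier_filled_ellipse: "frontier (filled_ellipse \<alpha> a b) =
      {x. (x \<bullet> unit_normal \<alpha>)\<^sup>2 / a\<^sup>2 + (x \<bullet> unit_normal (\<alpha> + pi / 2))\<^sup>2 / b\<^sup>2 = 1}"
proof -
  let ?n = "unit_normal \<alpha>" and ?m = "unit_normal (\<alpha> + pi / 2)" and ?F = "filled_ellipse \<alpha> a b"
  \<comment> \<open>The linear map \<open>f\<close> sends the ellipse to the unit circle of the Euclidean product norm.\<close>
  define f where "f x = (x \<bullet> ?n / a, x \<bullet> ?m / b)" for x
  have f: "linear f"
    by (rule linearI) (auto simp: f_def inner_add_left add_divide_distrib)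
  have cont: "continuous_on UNIV f"
    by (simp add: f linear_continuous_on linear_conv_bounded_linear[symmetric])
  have norm_f: "norm (f x) = sqrt ((x \<bullet> ?n)\<^sup>2 / a\<^sup>2 + (x \<bullet> ?m)\<^sup>2 / b\<^sup>2)" for x
    by (simp add: f_def norm_Pair power_divide)
  have F: "?F = f -` cball 0 1"
    by (simp add: filled_ellipse_def vimage_def norm_f)
  show "convex ?F" unfolding F by (intro convex_linear_vimage f convex_cball)
  have closed: "closed ?F" unfolding F by (intro closed_vimage cont closed_cball)
  have "norm x \<le> a + b" if "x \<in> ?F" for x
  proof -
    have "\<bar>x \<bullet> ?n / a\<bar> \<le> 1" "\<bar>x \<bullet> ?m / b\<bar> \<le> 1"
      using that norm_fst_le[of "fst (f x)" "snd (f x)"] norm_snd_le[of "snd (f x)" "fst (f x)"]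
      by (auto simp: F f_def)
    then have "\<bar>x \<bullet> ?n\<bar> \<le> a" "\<bar>x \<bullet> ?m\<bar> \<le> b" using assms by (auto simp: abs_divide)
    moreover have "norm x \<le> \<bar>x \<bullet> ?n\<bar> + \<bar>x \<bullet> ?m\<bar>"
      by (subst plane_expansion[of x \<alpha>], rule norm_triangle_le) simp
    ultimately show ?thesis by linarith
  qed
  then have "bounded ?F" by (auto simp: bounded_iff)
  with closed show "compact ?F" by (simp add: compact_eq_bounded_closed)
  have "0 \<in> ?F" by (simp add: filled_ellipse_def)
  then show "?F \<noteq> {}" by blast
  have int: "interior ?F = f -` ball 0 1"
  proof (rule interior_unique)
    show "f -` ball 0 1 \<subseteq> ?F" "open (f -` ball 0 1)"
      by (auto simp: F intro!: open_vimage cont)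
    fix U assume U: "U \<subseteq> ?F" "open U"
    show "U \<subseteq> f -` ball 0 1"
    proof
      fix x assume "x \<in> U"
      then obtain e where e: "e > 0" "ball x e \<subseteq> U" using U(2) openE by blast
      \<comment> \<open>Stretching \<open>x\<close> slightly keeps it in \<open>U\<close>, so \<open>f x\<close> cannot have norm 1 already.\<close>
      define d where "d = e / (2 * (norm x + 1))"
      have d: "d > 0" using e by (simp add: d_def add_nonneg_pos)
      have "norm x / (2 * (norm x + 1)) < 1" by (simp add: divide_less_eq add_nonneg_pos)
      then have "e * (norm x / (2 * (norm x + 1))) < e * 1" using e(1) by (intro mult_strict_left_mono)
      then have "d * norm x < e" by (simp add: d_def)
      then have "(1 + d) *\<^sub>R x \<in> ball x e"
        using d by (simp add: dist_norm scaleR_add_left)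
      then have "(1 + d) *\<^sub>R x \<in> ?F" using e(2) U(1) by blast
      then have le1: "(1 + d) * norm (f x) \<le> 1"
        using d by (simp add: F linear_cmul[OF f])
      have "norm (f x) < 1"
      proof (rule ccontr)
        assume "\<not> norm (f x) < 1"
        then have "(1 + d) * 1 \<le> (1 + d) * norm (f x)"
          using d by (intro mult_left_mono) auto
        from order_trans[OF this le1] d show False by simp
      qed
      then show "x \<in> f -` ball 0 1" by simp
    qed
  qed
  have "frontier ?F = ?F - interior ?F"
    using closed by (simp add: frontier_def)
  also have "\<dots> = {x. norm (f x) = 1}"
    unfolding int by (auto simp: F)
  finally show "frontier ?F = {x. (x \<bullet> ?n)\<^sup>2 / a\<^sup>2 + (x \<bullet> ?m)\<^sup>2 / b\<^sup>2 = 1}"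
    by (simp add: norm_f)
qed

text \<open>The upper bound is the Cauchy-Schwarz inequality for \<open>(X, Y)\<close>, the coordinates of the point
  in units of the semi-axes, and \<open>(a cos (\<theta> - \<alpha>), b sin (\<theta> - \<alpha>))\<close>; the point \<open>y\<close> below is the case of
  equality.\<close>

lemma support_fun_filled_ellipse:
  assumes "a > 0" "b > 0"
  shows "support_fun (filled_ellipse \<alpha> a b) \<theta> = sqrt (a\<^sup>2 * (cos (\<theta> - \<alpha>))\<^sup>2 + b\<^sup>2 * (sin (\<theta> - \<alpha>))\<^sup>2)"
proof -
  let ?n = "unit_normal \<alpha>" and ?m = "unit_normal (\<alpha> + pi / 2)"
  define c s where "c = cos (\<theta> - \<alpha>)" and "s = sin (\<theta> - \<alpha>)"
  define h where "h = sqrt (a\<^sup>2 * c\<^sup>2 + b\<^sup>2 * s\<^sup>2)"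
  have "c \<noteq> 0 \<or> s \<noteq> 0"
    using sin_cos_squared_add[of "\<theta> - \<alpha>"] unfolding c_def s_def by fastforce
  then have h: "h > 0"
    using assms by (auto simp: h_def intro: add_pos_nonneg add_nonneg_pos)
  have h2: "h\<^sup>2 = a\<^sup>2 * c\<^sup>2 + b\<^sup>2 * s\<^sup>2" by (simp add: h_def)
  have n: "x \<bullet> unit_normal \<theta> = c * (x \<bullet> ?n) + s * (x \<bullet> ?m)" for x
  proof -
    have "unit_normal \<theta> \<bullet> ?n = c" "unit_normal \<theta> \<bullet> ?m = s"
      by (simp_all add: inner_unit_normals c_def s_def diff_diff_eq[symmetric] cos_diff[of _ "pi / 2"])
    then have "unit_normal \<theta> = c *\<^sub>R ?n + s *\<^sub>R ?m"
      using plane_expansion[of "unit_normal \<theta>" \<alpha>] by simp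
    then show ?thesis by (simp add: inner_add_right)
  qed
  have orth: "?n \<bullet> ?n = 1" "?m \<bullet> ?m = 1" "?n \<bullet> ?m = 0" "?m \<bullet> ?n = 0"
    by (simp_all add: inner_unit_normals)
  define y where "y = (a\<^sup>2 * c / h) *\<^sub>R ?n + (b\<^sup>2 * s / h) *\<^sub>R ?m"
  have yn: "y \<bullet> ?n = a\<^sup>2 * c / h" "y \<bullet> ?m = b\<^sup>2 * s / h"
    by (simp_all add: y_def inner_add_left orth)
  have "(y \<bullet> ?n)\<^sup>2 / a\<^sup>2 + (y \<bullet> ?m)\<^sup>2 / b\<^sup>2 = (a\<^sup>2 * c\<^sup>2 + b\<^sup>2 * s\<^sup>2) / h\<^sup>2"
    using assms h by (simp add: yn add_divide_distrib) (simp add: power2_eq_square field_simps)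
  also have "\<dots> = 1" using h by (simp flip: h2)
  finally have y: "y \<in> filled_ellipse \<alpha> a b"
    by (simp add: filled_ellipse_def)
  have "y \<bullet> unit_normal \<theta> = (a\<^sup>2 * c\<^sup>2 + b\<^sup>2 * s\<^sup>2) / h"
    by (simp add: n yn add_divide_distrib power2_eq_square mult_ac)
  also have "\<dots> = h" using h unfolding h2[symmetric] by (simp add: power2_eq_square)
  finally have yh: "y \<bullet> unit_normal \<theta> = h" .
  have le: "x \<bullet> unit_normal \<theta> \<le> h" if "x \<in> filled_ellipse \<alpha> a b" for x
  proof -
    define X Y where "X = x \<bullet> ?n / a" and "Y = x \<bullet> ?m / b"
    have XY: "X\<^sup>2 + Y\<^sup>2 \<le> 1"
      using that by (simp add: filled_ellipse_def X_def Y_def power_divide)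
    have "x \<bullet> unit_normal \<theta> = (X, Y) \<bullet> (a * c, b * s)"
      using assms by (simp add: n X_def Y_def)
    also have "\<dots> \<le> norm (X, Y) * norm (a * c, b * s)" by (rule norm_cauchy_schwarz)
    also have "\<dots> \<le> 1 * norm (a * c, b * s)"
      using XY by (intro mult_right_mono) (auto simp: norm_Pair)
    also have "\<dots> = h" by (simp add: norm_Pair h_def power_mult_distrib)
    finally show ?thesis .
  qed
  show ?thesis
    unfolding support_fun_def c_def[symmetric] s_def[symmetric] h_def[symmetric]
    by (rule cSup_eq_maximum) (use y yh le in \<open>auto intro: image_eqI[of _ _ y]\<close>)
qed

lemma centered_ellipse_frontier_iff:
  assumes "compact K" "convex K" "K \<noteq> {}"
  shows "centered_ellipse (frontier K) \<longleftrightarrow> (\<exists>\<alpha> a b. a > 0 \<and> b > 0 \<and>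
    (\<forall>\<theta>. support_fun K \<theta> = sqrt (a\<^sup>2 * (cos (\<theta> - \<alpha>))\<^sup>2 + b\<^sup>2 * (sin (\<theta> - \<alpha>))\<^sup>2)))"
proof -
  have "frontier K = {x. (x \<bullet> unit_normal \<alpha>)\<^sup>2 / a\<^sup>2 + (x \<bullet> unit_normal (\<alpha> + pi / 2))\<^sup>2 / b\<^sup>2 = 1}
      \<longleftrightarrow> (\<forall>\<theta>. support_fun K \<theta> = sqrt (a\<^sup>2 * (cos (\<theta> - \<alpha>))\<^sup>2 + b\<^sup>2 * (sin (\<theta> - \<alpha>))\<^sup>2))"
    if "a > 0" "b > 0" for \<alpha> a b
  proof -
    note F = compact_filled_ellipse[OF that, of \<alpha>] convex_filled_ellipse[OF that, of \<alpha>]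
      filled_ellipse_nonempty[OF that, of \<alpha>]
    have "frontier K = frontier (filled_ellipse \<alpha> a b) \<longleftrightarrow> K = filled_ellipse \<alpha> a b"
      using frontier_inject[OF assms F] by blast
    also have "\<dots> \<longleftrightarrow> (\<forall>\<theta>. support_fun K \<theta> = support_fun (filled_ellipse \<alpha> a b) \<theta>)"
      using support_fun_inject[OF assms F] by blast
    finally show ?thesis
      by (simp add: frontier_filled_ellipse[OF that] support_fun_filled_ellipse[OF that])
  qed
  then show ?thesis
    unfolding centered_ellipse_polar by (simp cong: conj_cong)
qed

section \<open>Constant centro-affine curvature\<close>

text \<open>Rotating the phase vector \<open>(z, z' / 2)\<close> back by the angle \<open>2 * x\<close> makes it constant; \<open>f\<close> and \<open>g\<close>
  are its rotated coordinates.\<close>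

lemma harmonic_oscillator:
  fixes z z' :: "real \<Rightarrow> real"
  assumes z: "\<And>x. (z has_real_derivative z' x) (at x)"
    and z': "\<And>x. (z' has_real_derivative - 4 * z x) (at x)"
  obtains B C where "\<And>x. z x = B * cos (2 * x) + C * sin (2 * x)"
proof -
  define f g where "f x = z x * cos (2 * x) - z' x / 2 * sin (2 * x)"
    and "g x = z x * sin (2 * x) + z' x / 2 * cos (2 * x)" for x
  have "(f has_real_derivative 0) (at x)" "(g has_real_derivative 0) (at x)" for x
    unfolding f_def[abs_def] g_def[abs_def]
    by (rule derivative_eq_intros z z' refl | simp)+
  then have const: "f x = f 0" "g x = g 0" for x
    using DERIV_isconst_all by blast+
  have "z x = f x * cos (2 * x) + g x * sin (2 * x)" for x
    unfolding f_def g_def using sin_cos_squared_add[of "2 * x"] by algebra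
  then show ?thesis using that[of "f 0" "g 0"] const by metis
qed

text \<open>The equation \<open>s'' + s = A / s\<^sup>3\<close> of Ermakov and Pinney is linearised by passing to \<open>s\<^sup>2\<close>. It has the
  conserved energy \<open>s'\<^sup>2 + s\<^sup>2 + A / s\<^sup>2 = 2 * E\<close>, by means of which \<open>z = s\<^sup>2 - E\<close> is seen to satisfy
  \<open>z'' = - 4 * z\<close>. Thus \<open>s\<^sup>2 = E + R * cos (2 * (x - \<alpha>))\<close>, and positivity of \<open>s\<close> at \<open>\<alpha>\<close> and at
  \<open>\<alpha> + pi / 2\<close> makes \<open>E + R\<close> and \<open>E - R\<close> squares of semi-axes.\<close>

lemma ermakov_pinney:
  fixes s s' s'' :: "real \<Rightarrow> real"
  assumes s: "\<And>x. (s has_real_derivative s' x) (at x)"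
    and s': "\<And>x. (s' has_real_derivative s'' x) (at x)"
    and pos: "\<And>x. s x > 0"
    and eq: "\<And>x. s x ^ 3 * (s'' x + s x) = A"
  obtains \<alpha> a b where "a > 0" "b > 0"
    "\<And>x. s x = sqrt (a\<^sup>2 * (cos (x - \<alpha>))\<^sup>2 + b\<^sup>2 * (sin (x - \<alpha>))\<^sup>2)"
proof -
  have s''_eq: "s'' x = A / s x ^ 3 - s x" for x
    using eq[of x] pos[of x] by (simp add: field_simps)
  define e where "e x = (s' x)\<^sup>2 + (s x)\<^sup>2 + A / (s x)\<^sup>2" for x
  have "(e has_real_derivative 0) (at x)" for x
  proof -
    have ne: "s x \<noteq> 0" using pos[of x] by simp
    have "(e has_real_derivative
        2 * s' x * s'' x + 2 * s x * s' x - A * (2 * s x * s' x) / ((s x)\<^sup>2)\<^sup>2) (at x)"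
      unfolding e_def[abs_def]
      by (rule derivative_eq_intros s s' refl | use ne in \<open>simp add: power2_eq_square\<close>)+
    moreover have "2 * s' x * s'' x + 2 * s x * s' x - A * (2 * s x * s' x) / ((s x)\<^sup>2)\<^sup>2 = 0"
      using ne unfolding s''_eq by (simp add: field_simps power2_eq_square power3_eq_cube)
    ultimately show ?thesis by simp
  qed
  then have e: "e x = e 0" for x
    using DERIV_isconst_all by blast
  define E where "E = e 0 / 2"
  have d1: "((\<lambda>x. (s x)\<^sup>2 - E) has_real_derivative 2 * s x * s' x) (at x)" for x
    by (rule derivative_eq_intros s refl | simp)+
  have d2: "((\<lambda>x. 2 * s x * s' x) has_real_derivative - 4 * ((s x)\<^sup>2 - E)) (at x)" for x
  proof -
    have ne: "s x \<noteq> 0" using pos[of x] by simp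
    have d: "((\<lambda>x. 2 * s x * s' x) has_real_derivative 2 * (s' x)\<^sup>2 + 2 * s x * s'' x) (at x)"
      by (rule derivative_eq_intros s s' refl | simp add: power2_eq_square)+
    have "s x * s'' x = A / (s x)\<^sup>2 - (s x)\<^sup>2"
      using ne unfolding s''_eq by (simp add: field_simps power2_eq_square power3_eq_cube)
    moreover have "(s' x)\<^sup>2 + (s x)\<^sup>2 + A / (s x)\<^sup>2 = 2 * E"
      using e[of x] by (simp add: e_def[of x] E_def)
    ultimately have "2 * (s' x)\<^sup>2 + 2 * s x * s'' x = - 4 * ((s x)\<^sup>2 - E)"
      by (simp add: algebra_simps)
    with d show ?thesis by simp
  qed
  obtain B C where BC: "\<And>x. (s x)\<^sup>2 - E = B * cos (2 * x) + C * sin (2 * x)"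
    using harmonic_oscillator[OF d1 d2] by blast
  obtain \<phi> where "(vector [B, C] :: real^2) = norm (vector [B, C] :: real^2) *\<^sub>R unit_normal \<phi>"
    using polar_form by blast
  then have "B = norm (vector [B, C] :: real^2) * cos \<phi> \<and> C = norm (vector [B, C] :: real^2) * sin \<phi>"
    by (simp add: vec_eq_iff forall_2 unit_normal_def)
  then obtain R where R: "B = R * cos \<phi>" "C = R * sin \<phi>"
    by blast
  define \<alpha> where "\<alpha> = \<phi> / 2"
  have s2: "(s x)\<^sup>2 = E + R * cos (2 * (x - \<alpha>))" for x
  proof -
    have "cos (2 * (x - \<alpha>)) = cos (2 * x - \<phi>)" by (simp add: \<alpha>_def algebra_simps)
    then show ?thesis using BC[of x] R by (simp add: cos_diff algebra_simps)
  qed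
  have "E + R = (s \<alpha>)\<^sup>2" "E - R = (s (\<alpha> + pi / 2))\<^sup>2"
    by (simp_all add: s2)
  then have "E + R > 0" "E - R > 0"
    using zero_less_power[OF pos] by metis+
  have "s x = sqrt ((sqrt (E + R))\<^sup>2 * (cos (x - \<alpha>))\<^sup>2 + (sqrt (E - R))\<^sup>2 * (sin (x - \<alpha>))\<^sup>2)" for x
  proof -
    have "(s x)\<^sup>2 = (E + R) * (cos (x - \<alpha>))\<^sup>2 + (E - R) * (sin (x - \<alpha>))\<^sup>2"
      unfolding s2 cos_double using sin_cos_squared_add[of "x - \<alpha>"] by algebra
    then show ?thesis
      using pos[of x] \<open>E + R > 0\<close> \<open>E - R > 0\<close> by (simp add: real_sqrt_unique)
  qed
  then show ?thesis
    using that[of "sqrt (E + R)" "sqrt (E - R)" \<alpha>] \<open>E + R > 0\<close> \<open>E - R > 0\<close> by simp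
qed

text \<open>Differentiating \<open>s\<^sup>2 = E + R * cos (2 * (x - \<alpha>))\<close> twice determines \<open>s * s'\<close> and
  \<open>s'\<^sup>2 + s * s''\<close>, and the left-hand side is a polynomial in these and \<open>s\<^sup>2\<close>.\<close>

lemma ermakov_pinney_converse:
  fixes s s' s'' :: "real \<Rightarrow> real"
  assumes s: "\<And>x. (s has_real_derivative s' x) (at x)"
    and s': "\<And>x. (s' has_real_derivative s'' x) (at x)"
    and eq: "\<And>x. s x = sqrt (a\<^sup>2 * (cos (x - \<alpha>))\<^sup>2 + b\<^sup>2 * (sin (x - \<alpha>))\<^sup>2)"
  shows "s x ^ 3 * (s'' x + s x) = a\<^sup>2 * b\<^sup>2"
proof -
  define E R where "E = (a\<^sup>2 + b\<^sup>2) / 2" and "R = (a\<^sup>2 - b\<^sup>2) / 2"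
  define c d where "c x = cos (2 * (x - \<alpha>))" and "d x = sin (2 * (x - \<alpha>))" for x
  have s2: "(s x)\<^sup>2 = E + R * c x" for x
  proof -
    have "(s x)\<^sup>2 = a\<^sup>2 * (cos (x - \<alpha>))\<^sup>2 + b\<^sup>2 * (sin (x - \<alpha>))\<^sup>2"
      by (simp add: eq)
    also have "\<dots> = E + R * c x"
      unfolding E_def R_def c_def cos_double sin_squared_eq by (simp add: field_simps)
    finally show ?thesis .
  qed
  have d1: "s x * s' x = - R * d x" for x
  proof -
    have "((\<lambda>x. (s x)\<^sup>2) has_real_derivative 2 * s x * s' x) (at x)"
      by (rule derivative_eq_intros s refl | simp)+
    moreover have "((\<lambda>x. (s x)\<^sup>2) has_real_derivative - 2 * R * d x) (at x)"
      unfolding s2 c_def d_def by (rule derivative_eq_intros refl | simp)+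
    ultimately show ?thesis using DERIV_unique by fastforce
  qed
  have d2: "(s' x)\<^sup>2 + s x * s'' x = - 2 * R * c x"
  proof -
    have "((\<lambda>x. s x * s' x) has_real_derivative (s' x)\<^sup>2 + s x * s'' x) (at x)"
      by (rule derivative_eq_intros s s' refl | simp add: power2_eq_square)+
    moreover have "((\<lambda>x. s x * s' x) has_real_derivative - 2 * R * c x) (at x)"
      unfolding d1 c_def d_def by (rule derivative_eq_intros refl | simp)+
    ultimately show ?thesis using DERIV_unique by blast
  qed
  have cd: "(c x)\<^sup>2 + (d x)\<^sup>2 = 1"
    by (simp add: c_def d_def)
  have "s x ^ 3 * (s'' x + s x) = (s x)\<^sup>2 * (s x * s'' x) + ((s x)\<^sup>2)\<^sup>2"
    by (simp add: algebra_simps power2_eq_square power3_eq_cube)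
  also have "\<dots> = (s x)\<^sup>2 * (- 2 * R * c x) - (s x * s' x)\<^sup>2 + ((s x)\<^sup>2)\<^sup>2"
    unfolding d2[symmetric] by (simp add: algebra_simps power2_eq_square)
  also have "\<dots> = E\<^sup>2 - R\<^sup>2"
    unfolding d1 s2 using cd by algebra
  also have "\<dots> = a\<^sup>2 * b\<^sup>2"
    by (simp add: E_def R_def field_simps power2_eq_square)
  finally show ?thesis .
qed

text \<open>The quantity \<open>s\<^sup>3 * (s'' + s)\<close> is the reciprocal of the centro-affine curvature \<open>\<kappa> / s\<^sup>3\<close> that
  drives the flow.\<close>

lemma ellipse_iff_centro_affine_curvature_const:
  assumes "K \<in> K_sym"
  shows "centered_ellipse (frontier K) \<longleftrightarrow>
    (\<exists>A. \<forall>\<theta>. support_fun K \<theta> ^ 3 * radius_of_curvature K \<theta> = A)"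
proof -
  note s = DERIV_support_fun[OF assms] DERIV2_support_fun[OF assms]
  have "(\<exists>\<alpha> a b. a > 0 \<and> b > 0 \<and> (\<forall>\<theta>. support_fun K \<theta> =
      sqrt (a\<^sup>2 * (cos (\<theta> - \<alpha>))\<^sup>2 + b\<^sup>2 * (sin (\<theta> - \<alpha>))\<^sup>2))) \<longleftrightarrow>
    (\<exists>A. \<forall>\<theta>. support_fun K \<theta> ^ 3 * radius_of_curvature K \<theta> = A)" (is "?l \<longleftrightarrow> ?r")
  proof
    assume ?l
    then obtain \<alpha> a b where
      "\<And>\<theta>. support_fun K \<theta> = sqrt (a\<^sup>2 * (cos (\<theta> - \<alpha>))\<^sup>2 + b\<^sup>2 * (sin (\<theta> - \<alpha>))\<^sup>2)"
      by blast
    from ermakov_pinney_converse[OF s this] show ?r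
      unfolding radius_of_curvature_def by blast
  next
    assume ?r
    then obtain A where
      "\<And>\<theta>. support_fun K \<theta> ^ 3 * (deriv (deriv (support_fun K)) \<theta> + support_fun K \<theta>) = A"
      unfolding radius_of_curvature_def by blast
    from ermakov_pinney[OF s support_fun_pos[OF assms] this] show ?l by metis
  qed
  then show ?thesis
    using centered_ellipse_frontier_iff[OF K_sym_compact K_sym_convex K_sym_nonempty] assms by simp
qed

section \<open>The flow in terms of the radius of curvature\<close>

lemma centro_affine_flow_support_fun:
  assumes "centro_affine_flow p T K" and t: "t \<in> time_interval T"
  shows "K t \<in> K_sym"
    and "((\<lambda>\<tau>. support_fun (K \<tau>) \<theta>) has_real_derivative
      support_fun (K t) \<theta> * (support_fun (K t) \<theta> ^ 3 * radius_of_curvature (K t) \<theta>) powr (p / (p + 2)))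
      (at t within time_interval T)"
proof -
  show Kt: "K t \<in> K_sym" using assms by (simp add: centro_affine_flow_def)
  have "support_fun (K t) \<theta> > 0" "radius_of_curvature (K t) \<theta> > 0"
    using support_fun_pos[OF Kt] radius_of_curvature_pos[OF Kt] by auto
  then have "(curvature (K t) \<theta> / support_fun (K t) \<theta> ^ 3) powr - (p / (p + 2)) =
      (support_fun (K t) \<theta> ^ 3 * radius_of_curvature (K t) \<theta>) powr (p / (p + 2))"
    by (simp add: curvature_def powr_minus_divide powr_divide powr_mult mult.commute
        flip: radius_of_curvature_def)
  then show "((\<lambda>\<tau>. support_fun (K \<tau>) \<theta>) has_real_derivative
      support_fun (K t) \<theta> * (support_fun (K t) \<theta> ^ 3 * radius_of_curvature (K t) \<theta>) powr (p / (p + 2)))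
      (at t within time_interval T)"
    using assms unfolding centro_affine_flow_def by metis
qed

lemma time_interval_down: "t \<in> time_interval T \<Longrightarrow> {0..t} \<subseteq> time_interval T"
  by (auto simp: time_interval_def intro: le_less_trans[of "ereal _" "ereal t"])

section \<open>Homothetic solutions have constant centro-affine curvature\<close>

text \<open>For a homothetic solution \<open>s \<theta> t / s \<theta> 0 = c t\<close> does not depend on \<open>\<theta>\<close>, so neither does its
  derivative at time 0, which the flow gives as a power of \<open>s\<^sup>3 * (s'' + s)\<close>.\<close>

lemma homothetic_imp_centro_affine_curvature_const:
  assumes flow: "centro_affine_flow p T K" and "p \<ge> 1" "T > 0" and hom: "homothetic T K"
  shows "\<exists>A. \<forall>\<theta>. support_fun (K 0) \<theta> ^ 3 * radius_of_curvature (K 0) \<theta> = A"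
proof -
  let ?I = "time_interval T"
  define q where "q = p / (p + 2)"
  have q: "q \<noteq> 0" using \<open>p \<ge> 1\<close> by (simp add: q_def)
  have 0: "0 \<in> ?I" using \<open>T > 0\<close> by (simp add: time_interval_def zero_ereal_def)
  obtain r where r: "0 < ereal r" "ereal r < T"
    using ereal_dense2[OF \<open>T > 0\<close>] by (auto simp: zero_ereal_def)
  then have "{0..r} \<subseteq> ?I" by (intro time_interval_down) (simp add: time_interval_def)
  \<comment> \<open>One-sided derivatives at 0 are unique because the time interval does not reduce to 0.\<close>
  then have nontriv: "at 0 within ?I \<noteq> bot"
    using r islimpt_subset[of 0 "{0..r}"] by (simp add: trivial_limit_within islimpt_Icc)
  obtain c where c: "\<And>t. t \<in> ?I \<Longrightarrow> c t > 0" "\<And>t. t \<in> ?I \<Longrightarrow> K t = (\<lambda>x. c t *\<^sub>R x) ` K 0"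
    using hom unfolding homothetic_def by blast
  note K0 = centro_affine_flow_support_fun(1)[OF flow 0]
  define X where "X \<theta> = support_fun (K 0) \<theta> ^ 3 * radius_of_curvature (K 0) \<theta>" for \<theta>
  have X: "X \<theta> > 0" for \<theta>
    using support_fun_pos[OF K0, of \<theta>] radius_of_curvature_pos[OF K0, of \<theta>] by (simp add: X_def)
  have "(c has_real_derivative X \<theta> powr q) (at 0 within ?I)" for \<theta>
  proof (rule has_field_derivative_transform_within[where d = 1])
    have pos: "support_fun (K 0) \<theta> > 0" by (rule support_fun_pos[OF K0])
    show "((\<lambda>t. support_fun (K t) \<theta> / support_fun (K 0) \<theta>) has_real_derivative X \<theta> powr q) (at 0 within ?I)"
      using DERIV_cdivide[OF centro_affine_flow_support_fun(2)[OF flow 0], of \<theta> "support_fun (K 0) \<theta>"] pos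
      by (simp add: X_def q_def)
    show "support_fun (K t) \<theta> / support_fun (K 0) \<theta> = c t" if "t \<in> ?I" for t
      using support_fun_scaleR[OF K_sym_compact[OF K0] K_sym_nonempty[OF K0], of "c t" \<theta>] c[OF that] pos
      by simp
  qed (use 0 in auto)
  then have eq: "X \<theta> powr q = X \<phi> powr q" for \<theta> \<phi>
    using vector_derivative_unique_within[OF nontriv]
    unfolding has_real_derivative_iff_has_vector_derivative by blast
  have "X \<theta> = X \<phi>" for \<theta> \<phi>
    using arg_cong[OF eq[of \<theta> \<phi>], of "\<lambda>x. x powr (1 / q)"] q X
    by (simp add: powr_powr less_imp_le)
  then show ?thesis unfolding X_def by blast
qed

section \<open>Ellipses evolve homothetically\<close>

lemma angle_reduction:
  obtains \<phi> where "\<phi> \<in> {0..2 * pi}" "\<And>K. support_fun K \<phi> = support_fun K \<theta>"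
proof -
  obtain \<phi> where "0 \<le> \<phi>" "\<phi> \<le> 2 * pi" "cos \<theta> = cos \<phi>" "sin \<theta> = sin \<phi>"
    using sincos_total_2pi_le[OF sin_cos_squared_add2[of \<theta>]] by blast
  then show ?thesis using that[of \<phi>] by (simp add: support_fun_def unit_normal_def)
qed

lemma support_fun_flow_mono:
  assumes flow: "centro_affine_flow p T K" and t: "t \<in> time_interval T" and "0 \<le> \<tau>" "\<tau> \<le> t"
  shows "support_fun (K \<tau>) \<theta> \<le> support_fun (K t) \<theta>"
proof -
  define D where "D x = support_fun (K x) \<theta> *
      (support_fun (K x) \<theta> ^ 3 * radius_of_curvature (K x) \<theta>) powr (p / (p + 2))" for x
  have sub: "{\<tau>..t} \<subseteq> time_interval T"
    using time_interval_down[OF t] \<open>0 \<le> \<tau>\<close> by auto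
  have "((\<lambda>x. support_fun (K x) \<theta>) has_derivative (\<lambda>h. D x * h)) (at x within {\<tau>..t})"
    if "\<tau> \<le> x" "x \<le> t" for x
    using centro_affine_flow_support_fun(2)[OF flow subsetD[OF sub], of x \<theta>] that sub
    unfolding D_def by (auto simp: has_field_derivative_def intro: has_derivative_subset)
  then obtain x where x: "x \<in> {\<tau>..t}" "support_fun (K t) \<theta> - support_fun (K \<tau>) \<theta> = D x * (t - \<tau>)"
    using mvt_very_simple[OF \<open>\<tau> \<le> t\<close>, of "\<lambda>x. support_fun (K x) \<theta>" "\<lambda>x h. D x * h"] by blast
  have "D x \<ge> 0"
    unfolding D_def using support_fun_pos[OF centro_affine_flow_support_fun(1)[OF flow], of x \<theta>] x(1) sub
    by (intro mult_nonneg_nonneg) auto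
  then have "D x * (t - \<tau>) \<ge> 0" using \<open>\<tau> \<le> t\<close> by simp
  with x(2) show ?thesis by linarith
qed

text \<open>The flow provides continuity in time for each separate angle. Joint continuity follows because
  the bodies grow, so that all of them up to time \<open>t\<close> lie in one disc and their support functions
  share a Lipschitz constant.\<close>

lemma support_fun_flow_continuous:
  assumes flow: "centro_affine_flow p T K" and t: "t \<in> time_interval T"
  shows "continuous_on ({0..t} \<times> S) (\<lambda>(\<tau>, \<theta>). support_fun (K \<tau>) \<theta>)"
proof (rule continuous_on_TimesI)
  note I = subsetD[OF time_interval_down[OF t]]
  note K = centro_affine_flow_support_fun(1)[OF flow I]
  note Kt = centro_affine_flow_support_fun(1)[OF flow t]
  obtain R where R: "\<And>x. x \<in> K t \<Longrightarrow> norm x \<le> R"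
    using compact_imp_bounded[OF K_sym_compact[OF Kt]] by (auto simp: bounded_iff)
  have "K \<tau> \<subseteq> K t" if "\<tau> \<in> {0..t}" for \<tau>
    using that support_fun_flow_mono[OF flow t]
    by (intro support_fun_le_imp_subset K_sym_compact K_sym_convex K_sym_nonempty K Kt) auto
  then have "\<bar>support_fun (K \<tau>) \<theta> - support_fun (K \<tau>) \<phi>\<bar> \<le> R * \<bar>\<theta> - \<phi>\<bar>" if "\<tau> \<in> {0..t}" for \<tau> \<theta> \<phi>
    using that R by (intro support_fun_lipschitz K_sym_compact K_sym_nonempty K) auto
  moreover have "R \<ge> 0" using R K_sym_nonempty[OF Kt] norm_ge_zero order_trans by blast
  ultimately have "R-lipschitz_on X (support_fun (K \<tau>))" if "\<tau> \<in> {0..t}" for \<tau> X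
    using that by (intro lipschitz_onI) (auto simp: dist_real_def)
  then show "local_lipschitz {0..t} S (\<lambda>\<tau>. support_fun (K \<tau>))"
    by (intro local_lipschitzI exI[of _ 1]) (auto intro!: exI[of _ R])
  show "continuous_on {0..t} (\<lambda>\<tau>. support_fun (K \<tau>) \<theta>)" for \<theta>
    by (rule continuous_on_subset[OF DERIV_continuous_on time_interval_down[OF t]])
      (rule centro_affine_flow_support_fun(2)[OF flow])
qed

text \<open>The comparison behind the maximum principle: if \<open>L\<close> contains a dilate of \<open>K\<close> and touches it from
  outside, then \<open>L\<close> is the flatter of the two at the point of contact.\<close>

lemma radius_of_curvature_touching:
  assumes K: "K \<in> K_sym" and L: "L \<in> K_sym"
    and le: "\<And>\<phi>. u * support_fun K \<phi> \<le> support_fun L \<phi>"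
    and touch: "support_fun L \<theta> = u * support_fun K \<theta>"
  shows "u * radius_of_curvature K \<theta> \<le> radius_of_curvature L \<theta>"
proof -
  have "u * deriv (deriv (support_fun K)) \<theta> - deriv (deriv (support_fun L)) \<theta> \<le> 0"
  proof (rule second_derivative_at_max)
    show "((\<lambda>\<phi>. u * support_fun K \<phi> - support_fun L \<phi>) has_real_derivative
        u * deriv (support_fun K) \<phi> - deriv (support_fun L) \<phi>) (at \<phi>)" for \<phi>
      by (intro DERIV_diff DERIV_cmult DERIV_support_fun K L)
    show "((\<lambda>\<phi>. u * deriv (support_fun K) \<phi> - deriv (support_fun L) \<phi>) has_real_derivative
        u * deriv (deriv (support_fun K)) \<theta> - deriv (deriv (support_fun L)) \<theta>) (at \<theta>)"
      by (intro DERIV_diff DERIV_cmult DERIV2_support_fun K L)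
    show "u * support_fun K \<phi> - support_fun L \<phi> \<le> u * support_fun K \<theta> - support_fun L \<theta>" for \<phi>
      using le[of \<phi>] touch by simp
  qed
  then show ?thesis
    using touch by (simp add: radius_of_curvature_def distrib_left)
qed

text \<open>Uniqueness of the flow out of an ellipse, without constructing the homothetic solution. Put
  \<open>q = p / (p + 2)\<close>. A solution of the form \<open>s \<theta> t = u t * s \<theta> 0\<close> has \<open>u' = A powr q * u powr (1 + 4 * q)\<close>,
  so that \<open>u powr (- 4 * q)\<close> decreases at the constant rate \<open>4 * q * A powr q\<close>. For an arbitrary
  solution with the same initial body, let \<open>u\<close> be the ratio of the support functions and let \<open>w\<close> be
  the deviation of \<open>u powr (- 4 * q)\<close> from this linear law. Then
  \<open>\<partial>w / \<partial>t = 4 * q * (A powr q - X powr q)\<close>, where \<open>X\<close> is the value \<open>A\<close> with the initial radius of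
  curvature replaced by the current one divided by \<open>u\<close>. Where \<open>w\<close> is maximal, \<open>u\<close> is minimal, the
  current body touches a dilate of the initial one from outside, and so \<open>X \<ge> A\<close>; where \<open>w\<close> is
  minimal, the roles are exchanged. The maximum principle for \<open>w\<close> and \<open>- w\<close> gives \<open>w = 0\<close>. As the law
  is stated for \<open>u powr (- 4 * q)\<close> and not for \<open>u\<close>, it makes no reference to the time at which the
  homothetic solution blows up.\<close>

lemma flow_ratio_to_ellipse:
  assumes flow: "centro_affine_flow p T K" and p: "p \<ge> 1" and t: "t \<in> time_interval T"
    and A: "\<And>\<theta>. support_fun (K 0) \<theta> ^ 3 * radius_of_curvature (K 0) \<theta> = A"
  shows "(support_fun (K t) \<theta> / support_fun (K 0) \<theta>) powr (- 4 * (p / (p + 2))) =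
    1 - 4 * (p / (p + 2)) * A powr (p / (p + 2)) * t"
proof -
  define q where "q = p / (p + 2)"
  have q: "q > 0" using p by (simp add: q_def)
  note I = subsetD[OF time_interval_down[OF t]]
  note K = centro_affine_flow_support_fun(1)[OF flow I]
  have t0: "0 \<le> t" using t by (simp add: time_interval_def)
  have K0: "K 0 \<in> K_sym" using K[of 0] t0 by simp
  let ?s = "\<lambda>\<tau>. support_fun (K \<tau>)" and ?r = "\<lambda>\<tau>. radius_of_curvature (K \<tau>)"
  have s0: "?s 0 \<theta> > 0" for \<theta> by (rule support_fun_pos[OF K0])
  have s: "?s \<tau> \<theta> > 0" if "\<tau> \<in> {0..t}" for \<tau> \<theta> by (rule support_fun_pos[OF K[OF that]])
  have r: "?r \<tau> \<theta> > 0" if "\<tau> \<in> {0..t}" for \<tau> \<theta> by (rule radius_of_curvature_pos[OF K[OF that]])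
  have Apos: "A > 0" using A[of 0] s0[of 0] r[of 0 0] t0 by auto
  define u where "u \<theta> \<tau> = ?s \<tau> \<theta> / ?s 0 \<theta>" for \<theta> \<tau>
  have u: "u \<theta> \<tau> > 0" if "\<tau> \<in> {0..t}" for \<theta> \<tau> using s[OF that] s0 by (simp add: u_def)
  define X where "X \<theta> \<tau> = ?s 0 \<theta> ^ 3 * (?r \<tau> \<theta> / u \<theta> \<tau>)" for \<theta> \<tau>
  have X: "X \<theta> \<tau> > 0" if "\<tau> \<in> {0..t}" for \<theta> \<tau>
    using u[OF that, of \<theta>] s0[of \<theta>] r[OF that, of \<theta>] by (simp add: X_def)
  define w where "w \<theta> \<tau> = u \<theta> \<tau> powr (- 4 * q) + 4 * q * A powr q * \<tau> - 1" for \<theta> \<tau>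
  \<comment> \<open>The exponent is negative, so \<open>w\<close> and \<open>u\<close> are ordered oppositely.\<close>
  have w_le: "w \<theta> \<tau> \<le> w \<phi> \<tau> \<longleftrightarrow> u \<phi> \<tau> \<le> u \<theta> \<tau>" if "\<tau> \<in> {0..t}" for \<theta> \<phi> \<tau>
    using u[OF that, of \<theta>] u[OF that, of \<phi>] q powr_less_mono2_neg[of "- 4 * q"]
    by (cases "u \<theta> \<tau>" "u \<phi> \<tau>" rule: linorder_cases) (fastforce simp: w_def)+
  have dw: "(w \<theta> has_real_derivative 4 * q * (A powr q - X \<theta> \<tau> powr q)) (at \<tau> within {0..t})"
    if \<tau>: "\<tau> \<in> {0..t}" for \<theta> \<tau>
  proof -
    have ds: "((\<lambda>x. u \<theta> x) has_real_derivative u \<theta> \<tau> * (?s \<tau> \<theta> ^ 3 * ?r \<tau> \<theta>) powr q) (at \<tau> within {0..t})"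
      using DERIV_cdivide[OF DERIV_subset[OF centro_affine_flow_support_fun(2)[OF flow I[OF \<tau>]]
        time_interval_down[OF t]], of \<theta> "?s 0 \<theta>"]
      by (simp add: u_def q_def)
    have D: "(w \<theta> has_real_derivative (- 4 * q) * u \<theta> \<tau> powr (- 4 * q - 1) *
        (u \<theta> \<tau> * (?s \<tau> \<theta> ^ 3 * ?r \<tau> \<theta>) powr q) + 4 * q * A powr q) (at \<tau> within {0..t})"
      unfolding w_def[abs_def]
      by (rule derivative_eq_intros DERIV_chain'[OF ds has_real_derivative_powr[OF u[OF \<tau>]]] refl | simp)+
    have "u \<theta> \<tau> powr (- 4 * q - 1) * (u \<theta> \<tau> * (?s \<tau> \<theta> ^ 3 * ?r \<tau> \<theta>) powr q) = X \<theta> \<tau> powr q"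
    proof -
      have "u \<theta> \<tau> powr (- 4 * q - 1) * u \<theta> \<tau> = u \<theta> \<tau> powr (- 4 * q)"
        using u[OF \<tau>, of \<theta>] by (simp add: powr_diff)
      also have "\<dots> = ((1 / u \<theta> \<tau>) ^ 4) powr q"
        using u[OF \<tau>, of \<theta>]
        by (simp add: powr_minus_divide powr_divide powr_powr power_divide flip: powr_numeral)
      finally have "u \<theta> \<tau> powr (- 4 * q - 1) * (u \<theta> \<tau> * (?s \<tau> \<theta> ^ 3 * ?r \<tau> \<theta>) powr q) =
          ((1 / u \<theta> \<tau>) ^ 4 * (?s \<tau> \<theta> ^ 3 * ?r \<tau> \<theta>)) powr q"
        using u[OF \<tau>, of \<theta>] s[OF \<tau>, of \<theta>] r[OF \<tau>, of \<theta>] by (simp add: powr_mult flip: mult.assoc)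
      also have "(1 / u \<theta> \<tau>) ^ 4 * (?s \<tau> \<theta> ^ 3 * ?r \<tau> \<theta>) = X \<theta> \<tau>"
        using s[OF \<tau>, of \<theta>] s0[of \<theta>] by (simp add: u_def X_def field_simps eval_nat_numeral)
      finally show ?thesis .
    qed
    then show ?thesis
      using D by (simp only: mult.assoc mult_minus_left right_diff_distrib add.commute[of "- _"] add_uminus_conv_diff)
  qed
  have cont: "continuous_on ({0..t} \<times> {0..2 * pi}) (\<lambda>(\<tau>, \<theta>). w \<theta> \<tau>)"
  proof -
    have 1: "continuous_on ({0..t} \<times> {0..2 * pi}) (\<lambda>z. ?s (fst z) (snd z))"
      using support_fun_flow_continuous[OF flow t] by (simp add: case_prod_unfold)
    have "continuous_on UNIV (?s 0)"
      using DERIV_support_fun[OF K0] by (auto intro: DERIV_continuous_on)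
    then have 2: "continuous_on ({0..t} \<times> {0..2 * pi}) (\<lambda>z. ?s 0 (snd z))"
      by (intro continuous_on_compose2[of UNIV "?s 0" _ snd] continuous_intros) auto
    show ?thesis
      unfolding case_prod_unfold w_def u_def
      using s s0 by (intro continuous_intros 1 2) (auto simp: less_imp_neq[symmetric] dest: less_imp_neq)
  qed
  have le: "w \<phi> t \<le> 0" if "\<phi> \<in> {0..2 * pi}" for \<phi>
  proof (rule parabolic_max_principle[OF _ cont _ _ that t0])
    fix \<theta> \<tau> assume \<theta>: "\<theta> \<in> {0..2 * pi}" "0 < \<tau>" "\<tau> \<le> t"
      and ext: "\<And>\<phi>. \<phi> \<in> {0..2 * pi} \<Longrightarrow> w \<phi> \<tau> \<le> w \<theta> \<tau>"
    then have \<tau>: "\<tau> \<in> {0..t}" by simp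
    have min: "u \<theta> \<tau> \<le> u \<phi> \<tau>" for \<phi>
    proof -
      obtain \<phi>' where "\<phi>' \<in> {0..2 * pi}" "\<And>K. support_fun K \<phi>' = support_fun K \<phi>"
        using angle_reduction by blast
      then show ?thesis using ext[of \<phi>'] w_le[OF \<tau>] by (simp add: u_def)
    qed
    have "u \<theta> \<tau> * ?s 0 \<phi> \<le> ?s \<tau> \<phi>" for \<phi>
      using min[of \<phi>] s0[of \<phi>] by (simp add: u_def[of \<phi>] pos_le_divide_eq)
    moreover have "?s \<tau> \<theta> = u \<theta> \<tau> * ?s 0 \<theta>" using s0[of \<theta>] by (simp add: u_def)
    ultimately have "u \<theta> \<tau> * ?r 0 \<theta> \<le> ?r \<tau> \<theta>"
      by (rule radius_of_curvature_touching[OF K0 K[OF \<tau>]])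
    then have "?r 0 \<theta> \<le> ?r \<tau> \<theta> / u \<theta> \<tau>"
      using u[OF \<tau>, of \<theta>] by (simp add: pos_le_divide_eq mult.commute)
    then have "A \<le> X \<theta> \<tau>"
      using s0[of \<theta>] unfolding X_def A[of \<theta>, symmetric] by (intro mult_left_mono) simp_all
    then have "A powr q \<le> X \<theta> \<tau> powr q" using Apos q by (intro powr_mono2) auto
    then have "4 * q * (A powr q - X \<theta> \<tau> powr q) \<le> 0" using q by (simp add: mult_nonneg_nonpos)
    with dw[OF \<tau>, of \<theta>] show "\<exists>d\<le>0. (w \<theta> has_real_derivative d) (at \<tau> within {0..t})" by blast
  qed (use s0 in \<open>auto simp: w_def u_def less_imp_neq[symmetric]\<close>)
  have ge: "- w \<phi> t \<le> 0" if "\<phi> \<in> {0..2 * pi}" for \<phi>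
  proof (rule parabolic_max_principle[where w = "\<lambda>\<theta> \<tau>. - w \<theta> \<tau>", OF _ _ _ _ that t0])
    show "continuous_on ({0..t} \<times> {0..2 * pi}) (\<lambda>(\<tau>, \<theta>). - w \<theta> \<tau>)"
      using continuous_on_minus[OF cont] by (simp add: case_prod_unfold)
    fix \<theta> \<tau> assume \<theta>: "\<theta> \<in> {0..2 * pi}" "0 < \<tau>" "\<tau> \<le> t"
      and ext: "\<And>\<phi>. \<phi> \<in> {0..2 * pi} \<Longrightarrow> - w \<phi> \<tau> \<le> - w \<theta> \<tau>"
    then have \<tau>: "\<tau> \<in> {0..t}" by simp
    have max: "u \<phi> \<tau> \<le> u \<theta> \<tau>" for \<phi>
    proof -
      obtain \<phi>' where "\<phi>' \<in> {0..2 * pi}" "\<And>K. support_fun K \<phi>' = support_fun K \<phi>"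
        using angle_reduction by blast
      then show ?thesis using ext[of \<phi>'] w_le[OF \<tau>] by (simp add: u_def)
    qed
    have "1 / u \<theta> \<tau> * ?s \<tau> \<phi> \<le> ?s 0 \<phi>" for \<phi>
      using max[of \<phi>] s0[of \<phi>] u[OF \<tau>, of \<theta>] by (simp add: u_def[of \<phi>] pos_divide_le_eq mult.commute)
    moreover have "?s 0 \<theta> = 1 / u \<theta> \<tau> * ?s \<tau> \<theta>" using s0[of \<theta>] s[OF \<tau>, of \<theta>] by (simp add: u_def)
    ultimately have "1 / u \<theta> \<tau> * ?r \<tau> \<theta> \<le> ?r 0 \<theta>"
      by (rule radius_of_curvature_touching[OF K[OF \<tau>] K0])
    then have "X \<theta> \<tau> \<le> A"
      using s0[of \<theta>] unfolding X_def A[of \<theta>, symmetric] by (intro mult_left_mono) simp_all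
    then have "X \<theta> \<tau> powr q \<le> A powr q" using X[OF \<tau>, of \<theta>] q by (intro powr_mono2) auto
    then have "- (4 * q * (A powr q - X \<theta> \<tau> powr q)) \<le> 0" using q by (simp add: mult_nonneg_nonneg)
    with DERIV_minus[OF dw[OF \<tau>, of \<theta>]]
    show "\<exists>d\<le>0. ((\<lambda>\<tau>. - w \<theta> \<tau>) has_real_derivative d) (at \<tau> within {0..t})" by blast
  qed (use s0 in \<open>auto simp: w_def u_def less_imp_neq[symmetric]\<close>)
  obtain \<phi> where \<phi>: "\<phi> \<in> {0..2 * pi}" "\<And>K. support_fun K \<phi> = support_fun K \<theta>"
    using angle_reduction by blast
  have "w \<phi> t = 0" using le[OF \<phi>(1)] ge[OF \<phi>(1)] by simp
  then show ?thesis by (simp add: w_def u_def q_def \<phi>(2))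
qed

lemma centro_affine_curvature_const_imp_homothetic:
  assumes flow: "centro_affine_flow p T K" and p: "p \<ge> 1" and "T > 0"
    and A: "\<And>\<theta>. support_fun (K 0) \<theta> ^ 3 * radius_of_curvature (K 0) \<theta> = A"
  shows "homothetic T K"
  unfolding homothetic_def
proof (intro exI ballI conjI)
  define q where "q = p / (p + 2)"
  have q: "q \<noteq> 0" using p by (simp add: q_def)
  define c where "c t = support_fun (K t) 0 / support_fun (K 0) 0" for t
  have "0 \<in> time_interval T" using \<open>T > 0\<close> by (simp add: time_interval_def zero_ereal_def)
  note K0 = centro_affine_flow_support_fun(1)[OF flow this]
  fix t assume t: "t \<in> time_interval T"
  note Kt = centro_affine_flow_support_fun(1)[OF flow t]
  note pos = support_fun_pos[OF K0] support_fun_pos[OF Kt]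
  show c: "c t > 0" using pos by (simp add: c_def)
  have eq: "support_fun (K t) \<theta> / support_fun (K 0) \<theta> = c t" for \<theta>
  proof -
    have "(support_fun (K t) \<theta> / support_fun (K 0) \<theta>) powr (- 4 * q) = c t powr (- 4 * q)"
      unfolding c_def q_def flow_ratio_to_ellipse[OF flow p t A] ..
    then have "((support_fun (K t) \<theta> / support_fun (K 0) \<theta>) powr (- 4 * q)) powr (- 1 / (4 * q))
        = (c t powr (- 4 * q)) powr (- 1 / (4 * q))" by simp
    then show ?thesis
      using q pos[of \<theta>] c by (simp add: powr_powr)
  qed
  show "K t = (\<lambda>x. c t *\<^sub>R x) ` K 0"
  proof (rule support_fun_inject)
    show "support_fun (K t) \<theta> = support_fun ((\<lambda>x. c t *\<^sub>R x) ` K 0) \<theta>" for \<theta>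
      using eq[of \<theta>] c pos(1)[of \<theta>]
      by (simp add: support_fun_scaleR[OF K_sym_compact[OF K0] K_sym_nonempty[OF K0]] field_simps)
    show "compact ((\<lambda>x. c t *\<^sub>R x) ` K 0)" "convex ((\<lambda>x. c t *\<^sub>R x) ` K 0)" "(\<lambda>x. c t *\<^sub>R x) ` K 0 \<noteq> {}"
      using K_sym_nonempty[OF K0]
      by (auto intro: compact_scaling[OF K_sym_compact[OF K0]] convex_scaling[OF K_sym_convex[OF K0]])
  qed (rule K_sym_compact[OF Kt] K_sym_convex[OF Kt] K_sym_nonempty[OF Kt])+
qed

section \<open>Homothetic solutions of the flow\<close>

theorem proposition5p6:
  fixes p :: real and T :: ereal and K :: "real \<Rightarrow> (real^2) set"
  assumes "p \<ge> 1" and "T > 0" and "centro_affine_flow p T K"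
  shows "homothetic T K \<longleftrightarrow> centered_ellipse (frontier (K 0))"
proof -
  have "0 \<in> time_interval T" using \<open>T > 0\<close> by (simp add: time_interval_def zero_ereal_def)
  note K0 = centro_affine_flow_support_fun(1)[OF assms(3) this]
  show ?thesis
    unfolding ellipse_iff_centro_affine_curvature_const[OF K0]
    using homothetic_imp_centro_affine_curvature_const[OF assms(3,1,2)] centro_affine_curvature_const_imp_homothetic[OF assms(3,1,2)] by blast
qed

end
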